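(* Let $\mathscr{H}$ be a real Hilbert space, let $f:\mathscr{H}\to\mathbb{R}\cup\{+\infty\}$ be closed, convex and proper, let $\mathcal{S}:\mathscr{H}\to\mathscr{H}$ be a bijective, linear and continuous operator with adjoint $\mathcal{S}^*$, and let $\mathcal{M}=\mathcal{S}\mathcal{S}^*$. Then for every $\bm{v}\in\mathscr{H}$, $$\mathbf{Prox}_{f\mathcal{S}}(\bm{v})=\mathcal{S}^{-1}\mathbf{Prox}_{\mathcal{M}f}(\mathcal{S}\bm{v}),\qquad \mathbf{Prox}_{\mathcal{M}f}(\bm{v})=\mathcal{S}\,\mathbf{Prox}_{f\mathcal{S}}(\mathcal{S}^{-1}\bm{v}).$$
   Context: For a positive definite operator $\mathcal{M}$, the classical proximal operator is $\mathbf{Prox}_{\mathcal{M}f}(\bm{v})=\operatorname*{argmin}_{\bm{z}}\, f(\bm{z})+\frac12\|\bm{z}-\bm{v}\|^2_{\mathcal{M}^{-1}}$, where $\|\bm{u}\|_{\mathcal{A}}^2=\langle\bm{u},\mathcal{A}\bm{u}\rangle$. For a bijective, linear and continuous operator $\mathcal{S}$, the new proximal operator is $\mathbf{Prox}_{f\mathcal{S}}(\bm{v})=\operatorname*{argmin}_{\bm{z}}\, f(\mathcal{S}\bm{z})+\frac12\|\bm{z}-\bm{v}\|^2$. Both denote the unique minimizer. *)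

theory Defs
  imports "HOL-Analysis.Analysis"
begin

(* Functions into R \<union> {+\<infinity>} are ereal-valued; the value -\<infinity> is excluded by proper_fun.
   The library's epigraph covers real-valued functions only. *)
definition ereal_epigraph :: "('a \<Rightarrow> ereal) \<Rightarrow> ('a \<times> real) set" where
  "ereal_epigraph f = {(x, t). f x \<le> ereal t}"

definition closed_fun :: "('a::topological_space \<Rightarrow> ereal) \<Rightarrow> bool" where
  "closed_fun f \<longleftrightarrow> closed (ereal_epigraph f)"

definition convex_fun :: "('a::real_vector \<Rightarrow> ereal) \<Rightarrow> bool" where
  "convex_fun f \<longleftrightarrow> convex (ereal_epigraph f)"

definition proper_fun :: "('a \<Rightarrow> ereal) \<Rightarrow> bool" where
  "proper_fun f \<longleftrightarrow> (\<forall>x. f x \<noteq> -\<infinity>) \<and> (\<exists>x. f x \<noteq> \<infinity>)"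

definition the_minimizer :: "('a \<Rightarrow> ereal) \<Rightarrow> 'a" where
  "the_minimizer g = (THE z. is_arg_min g (\<lambda>_. True) z)"

definition weighted_norm_sq :: "('a::real_inner \<Rightarrow> 'a) \<Rightarrow> 'a \<Rightarrow> real" where
  "weighted_norm_sq A u = inner u (A u)"

(* The classical proximal operator; M is meant to be bijective, so that inv M is its inverse. *)
definition prox_classical ::
    "('a::real_inner \<Rightarrow> 'a) \<Rightarrow> ('a \<Rightarrow> ereal) \<Rightarrow> 'a \<Rightarrow> 'a" where
  "prox_classical M f v =
     the_minimizer (\<lambda>z. f z + ereal (1/2 * weighted_norm_sq (inv M) (z - v)))"

(* The new proximal operator: f is precomposed with S, the norm is unweighted. *)
definition prox_new ::
    "('a \<Rightarrow> ereal) \<Rightarrow> ('a::real_inner \<Rightarrow> 'a) \<Rightarrow> 'a \<Rightarrow> 'a" where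
  "prox_new f S v =
     the_minimizer (\<lambda>z. f (S z) + ereal (1/2 * (norm (z - v))\<^sup>2))"

end

theory Submission
  imports Defs
begin

text \<open>If \<open>M = S S\<^sup>*\<close>, then \<open>\<langle>u, M\<inverse> u\<rangle> = \<parallel>S\<inverse> u\<parallel>\<^sup>2\<close>, so the substitution \<open>z \<mapsto> S z\<close> turns one minimization problem
  into the other. For this to carry the minimizers along, they must exist and be unique, and the
  adjoint must exist and be bijective. Unique minimizers, the Riesz representation and the bounded
  inverse theorem all come from one fact: nested nonempty bounded closed convex sets in a Hilbert
  space have a common point.\<close>

section \<open>Nested closed convex sets in a Hilbert space\<close>

text \<open>The points of almost minimal norm in each set form a sequence of sets with vanishing diameter,
  by the parallelogram law.\<close>

lemma nested_closed_convex_nonempty: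
  fixes C :: "nat \<Rightarrow> 'a::{real_inner, complete_space} set"
  assumes closed: "\<And>n. closed (C n)" and convex: "\<And>n. convex (C n)"
    and nonempty: "\<And>n. C n \<noteq> {}" and mono: "\<And>m n. m \<le> n \<Longrightarrow> C n \<subseteq> C m"
    and bounded: "bounded (C 0)"
  obtains a where "\<And>n. a \<in> C n"
proof -
  define \<delta> where "\<delta> n = infdist 0 (C n)" for n
  obtain K where K: "\<And>x. x \<in> C 0 \<Longrightarrow> norm x \<le> K"
    using bounded by (auto simp: bounded_iff)
  have \<delta>_le: "\<delta> n \<le> norm x" if "x \<in> C n" for n x
    using infdist_le[OF that, of 0] by (simp add: \<delta>_def)
  have \<delta>_nonneg: "0 \<le> \<delta> n" for n
    by (simp add: \<delta>_def infdist_nonneg)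
  have inc: "incseq \<delta>"
    unfolding \<delta>_def by (intro monoI infdist_mono mono nonempty)
  moreover have "\<delta> n \<le> K" for n
  proof -
    obtain x where "x \<in> C n" using nonempty by blast
    then show ?thesis using \<delta>_le[of x n] K[of x] mono[of 0 n] by force
  qed
  ultimately obtain d where d: "\<delta> \<longlonglongrightarrow> d" and \<delta>_le_d: "\<And>n. \<delta> n \<le> d"
    using incseq_convergent[of \<delta> K] by auto
  \<comment> \<open>The slack puts \<open>e n\<close> strictly above \<open>\<delta> n\<close>, so
    the ball of radius \<open>e n\<close> meets \<open>C n\<close>; it vanishes in the
    limit.\<close>
  define e where "e n = d + inverse (real (Suc n))" for n
  define D where "D n = C n \<inter> cball 0 (e n)" for n
  have e: "e \<longlonglongrightarrow> d"
    unfolding e_def using tendsto_add[OF tendsto_const LIMSEQ_inverse_real_of_nat, of d] by simp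
  have D_ne: "D n \<noteq> {}" for n
  proof -
    have "(INF x\<in>C n. dist 0 x) < e n"
      using \<delta>_le_d[of n] nonempty[of n] by (simp add: e_def \<delta>_def infdist_notempty add_pos_nonneg le_less_trans)
    then obtain x where "x \<in> C n" "dist 0 x < e n"
      using nonempty[of n] by (subst (asm) cINF_less_iff) (auto intro!: bdd_belowI2[of _ 0])
    then show ?thesis by (auto simp: D_def)
  qed
  have "\<exists>n. \<forall>x\<in>D n. \<forall>y\<in>D n. dist x y < \<epsilon>" if "\<epsilon> > 0" for \<epsilon>
  proof -
    \<comment> \<open>This difference bounds the squared distance of two points of
      \<open>D n\<close>: their midpoint stays in \<open>C n\<close>, so its norm is at least
      \<open>\<delta> n\<close>.\<close>
    have "(\<lambda>n. 4 * (e n)\<^sup>2 - 4 * (\<delta> n)\<^sup>2) \<longlonglongrightarrow> 4 * d\<^sup>2 - 4 * d\<^sup>2"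
      by (intro tendsto_intros d e)
    then have "\<forall>\<^sub>F n in sequentially. 4 * (e n)\<^sup>2 - 4 * (\<delta> n)\<^sup>2 < \<epsilon>\<^sup>2"
      using that by (intro order_tendstoD(2)) auto
    then obtain n where n: "4 * (e n)\<^sup>2 - 4 * (\<delta> n)\<^sup>2 < \<epsilon>\<^sup>2"
      by (auto simp: eventually_sequentially)
    have "dist x y < \<epsilon>" if xy: "x \<in> D n" "y \<in> D n" for x y
    proof -
      have "(1/2) *\<^sub>R x + (1/2) *\<^sub>R y \<in> C n"
        using xy convexD[OF convex[of n], of x y "1/2" "1/2"] by (auto simp: D_def)
      then have "\<delta> n \<le> norm ((1/2) *\<^sub>R (x + y))"
        using \<delta>_le by (metis scaleR_add_right)
      then have "(2 * \<delta> n)\<^sup>2 \<le> (norm (x + y))\<^sup>2"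
        using \<delta>_nonneg[of n] by (intro power_mono) auto
      moreover have "(norm x)\<^sup>2 \<le> (e n)\<^sup>2" "(norm y)\<^sup>2 \<le> (e n)\<^sup>2"
        using xy by (auto simp: D_def intro!: power_mono)
      moreover have "(norm (x - y))\<^sup>2 = 2 * (norm x)\<^sup>2 + 2 * (norm y)\<^sup>2 - (norm (x + y))\<^sup>2"
        by (simp add: power2_norm_eq_inner inner_simps inner_commute)
      ultimately have "(dist x y)\<^sup>2 < \<epsilon>\<^sup>2"
        using n by (simp add: dist_norm power_mult_distrib)
      then show ?thesis
        using \<open>\<epsilon> > 0\<close> power2_less_imp_less by fastforce
    qed
    then show ?thesis by blast
  qed
  moreover have "closed (D n)" for n
    by (simp add: D_def closed closed_Int)
  moreover have "D n \<subseteq> D m" if "m \<le> n" for m n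
    using mono[OF that] that by (fastforce simp: D_def e_def intro: order_trans le_imp_inverse_le)
  ultimately show ?thesis
    using decreasing_closed_nest[of D] D_ne that by (metis D_def IntE)
qed

section \<open>The bounded inverse theorem\<close>

text \<open>By nested intersections the images of the closed balls are closed, so Baire's theorem gives
  one with nonempty interior, without any approximation argument.\<close>

lemma bounded_linear_inv:
  fixes S :: "'a::{real_inner, complete_space} \<Rightarrow> 'b::{real_normed_vector, complete_space}"
  assumes S: "bounded_linear S" and bij: "bij S"
  shows "bounded_linear (inv S)"
proof -
  interpret S: bounded_linear S by fact
  have inj: "inj S" and surj: "surj S" using bij by (auto simp: bij_def)
  have lin: "linear (inv S)"
    using S.linear_axioms bij_is_inj[OF bij] surj
    by (intro linearI) (auto intro!: inv_f_eq simp: S.add S.scaleR surj_f_inv_f)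
  define F where "F n = S ` cball 0 (real n)" for n
  have closed: "closed (F n)" for n
    unfolding closed_sequential_limits
  proof (intro allI impI, elim conjE)
    fix u y assume u: "\<forall>k. u k \<in> F n" and lim: "u \<longlonglongrightarrow> y"
    \<comment> \<open>Points of the ball that \<open>S\<close> sends ever closer to
      \<open>y\<close>; a common point is a preimage of \<open>y\<close>.\<close>
    define C where "C k = cball 0 (real n) \<inter> S -` cball y (inverse (real (Suc k)))" for k
    have "C k \<noteq> {}" for k
    proof -
      obtain i where "dist (u i) y < inverse (real (Suc k))"
        using lim by (metis inverse_positive_iff_positive metric_LIMSEQ_D of_nat_0_less_iff order_refl zero_less_Suc)
      then show ?thesis
        using u[rule_format, of i] by (auto simp: C_def F_def dist_commute intro: less_imp_le)
    qed
    moreover have "closed (C k)" for k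
      unfolding C_def by (intro closed_Int closed_vimage) (auto intro: S.continuous_on continuous_on_id)
    moreover have "convex (C k)" for k
      unfolding C_def by (intro convex_Int convex_linear_vimage convex_cball S.linear_axioms)
    moreover have "C k \<subseteq> C j" if "j \<le> k" for j k
      using that by (fastforce simp: C_def intro: order_trans le_imp_inverse_le)
    moreover have "bounded (C 0)"
      unfolding C_def by (simp add: bounded_Int)
    ultimately obtain x where x: "\<And>k. x \<in> C k"
      using nested_closed_convex_nonempty[of C] by metis
    have "dist y (S x) \<le> 0"
    proof (rule LIMSEQ_le_const[OF LIMSEQ_inverse_real_of_nat])
      show "\<exists>N. \<forall>k\<ge>N. dist y (S x) \<le> inverse (real (Suc k))"
        using x by (auto simp: C_def)
    qed
    then show "y \<in> F n"
      using x[of 0] by (auto simp: C_def F_def)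
  qed
  have cover: "\<Union>(range F) = UNIV"
  proof -
    have "y \<in> \<Union>(range F)" for y
    proof -
      obtain n where "norm (inv S y) \<le> real n"
        using real_arch_simple by blast
      then show ?thesis
        by (auto simp: F_def image_iff surj_f_inv_f[OF surj] intro!: exI[of _ n] bexI[of _ "inv S y"])
    qed
    then show ?thesis by blast
  qed
  have "\<exists>n. interior (F n) \<noteq> {}"
  proof (rule ccontr)
    assume *: "\<not> ?thesis"
    have "euclidean interior_of \<Union>(range F) = {}"
      using closed * completely_metrizable_space_euclidean
      by (intro Baire_category_alt) auto
    then show False
      by (simp add: cover)
  qed
  then obtain n y where "y \<in> interior (F n)" by blast
  then obtain \<delta> where \<delta>: "\<delta> > 0" "cball y \<delta> \<subseteq> F n"
    by (meson mem_interior_cball)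
  have bound: "norm (inv S z) \<le> real n" if "z \<in> cball y \<delta>" for z
    using that \<delta> by (auto simp: F_def inv_f_f[OF inj])
  \<comment> \<open>Subtracting the centre \<open>y\<close> moves the bound to a ball around 0, at
    the cost of a factor 2; scaling then gives the operator bound.\<close>
  have small: "norm (inv S h) \<le> 2 * real n" if "norm h \<le> \<delta>" for h
  proof -
    have "inv S h = inv S (y + h) - inv S y"
      by (simp add: linear_add[OF lin])
    then show ?thesis
      using bound[of y] bound[of "y + h"] \<delta>(1) that
        norm_triangle_ineq4[of "inv S (y + h)" "inv S y"]
      by (simp add: dist_norm)
  qed
  have "norm (inv S h) \<le> norm h * (2 * real n / \<delta>)" for h
  proof (cases "h = 0")
    case True then show ?thesis by (simp add: linear_0[OF lin])
  next
    case False
    then show ?thesis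
      using small[of "(\<delta> / norm h) *\<^sub>R h"] \<delta>(1)
      by (simp add: linear_cmul[OF lin] field_simps)
  qed
  then show ?thesis
    using lin by (intro bounded_linear_intro[of _ "2 * real n / \<delta>"])
      (auto simp: linear_add linear_cmul)
qed

section \<open>The proximal objective: strong convexity and sublevel sets\<close>

lemma convex_funD:
  assumes "convex_fun f" "f x \<le> ereal s" "f y \<le> ereal t" "0 \<le> a" "0 \<le> b" "a + b = 1"
  shows "f (a *\<^sub>R x + b *\<^sub>R y) \<le> ereal (a * s + b * t)"
proof -
  have "a *\<^sub>R (x, s) + b *\<^sub>R (y, t) \<in> ereal_epigraph f"
    using assms by (intro convexD) (simp_all add: convex_fun_def ereal_epigraph_def)
  then show ?thesis
    by (simp add: ereal_epigraph_def)
qed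

text \<open>The common form of both problems: each proximal operator is expressed through it, with
  \<open>f \<circ> S\<close> in place of \<open>f\<close>.\<close>

definition prox_objective :: "('a::real_inner \<Rightarrow> ereal) \<Rightarrow> 'a \<Rightarrow> 'a \<Rightarrow> ereal" where
  "prox_objective f v z = f z + ereal (1/2 * (norm (z - v))\<^sup>2)"

text \<open>The quadratic term is finite, so it moves across even where \<open>f\<close> is
  infinite. Sublevel sets thereby become preimages of the epigraph.\<close>

lemma prox_objective_le_iff:
  "prox_objective f v z \<le> ereal t \<longleftrightarrow> f z \<le> ereal (t - 1/2 * (norm (z - v))\<^sup>2)"
  unfolding prox_objective_def by (cases "f z") auto

text \<open>The squared norm satisfies the convexity inequality with an exact defect
  \<open>a * b * (norm (x - y))\<^sup>2\<close>. Real upper bounds \<open>s\<close> and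
  \<open>t\<close> replace the values, which keeps the arithmetic out of
  \<open>ereal\<close>.\<close>

lemma prox_objective_strongly_convex:
  assumes f: "convex_fun f" and x: "prox_objective f v x \<le> ereal s"
    and y: "prox_objective f v y \<le> ereal t" and ab: "0 \<le> a" "0 \<le> b" "a + b = 1"
  shows "prox_objective f v (a *\<^sub>R x + b *\<^sub>R y)
    \<le> ereal (a * s + b * t - 1/2 * (a * b * (norm (x - y))\<^sup>2))"
proof -
  have a: "a = 1 - b" using ab by simp
  have "(norm (a *\<^sub>R x + b *\<^sub>R y - v))\<^sup>2
    = a * (norm (x - v))\<^sup>2 + b * (norm (y - v))\<^sup>2 - a * b * (norm (x - y))\<^sup>2"
    unfolding a power2_norm_eq_inner
    by (simp add: inner_simps inner_commute algebra_simps)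
  then have "a * (s - 1/2 * (norm (x - v))\<^sup>2) + b * (t - 1/2 * (norm (y - v))\<^sup>2)
    = a * s + b * t - 1/2 * (a * b * (norm (x - y))\<^sup>2) - 1/2 * (norm (a *\<^sub>R x + b *\<^sub>R y - v))\<^sup>2"
    by (simp add: algebra_simps)
  with convex_funD[OF f x[unfolded prox_objective_le_iff] y[unfolded prox_objective_le_iff] ab]
  show ?thesis
    by (simp add: prox_objective_le_iff)
qed

lemma closed_prox_objective_sublevel:
  assumes "closed_fun f"
  shows "closed {z. prox_objective f v z \<le> ereal t}"
proof -
  have "{z. prox_objective f v z \<le> ereal t}
    = (\<lambda>z. (z, t - 1/2 * (norm (z - v))\<^sup>2)) -` ereal_epigraph f"
    by (auto simp: prox_objective_le_iff ereal_epigraph_def)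
  moreover have "closed \<dots>"
    using assms unfolding closed_fun_def
    by (intro closed_vimage) (auto intro!: continuous_intros)
  ultimately show ?thesis by simp
qed

lemma convex_prox_objective_sublevel:
  assumes "convex_fun f"
  shows "convex {z. prox_objective f v z \<le> ereal t}"
proof (rule convexI)
  fix x y and a b :: real
  assume xy: "x \<in> {z. prox_objective f v z \<le> ereal t}" "y \<in> {z. prox_objective f v z \<le> ereal t}"
    and ab: "0 \<le> a" "0 \<le> b" "a + b = 1"
  have "a * t + b * t - 1/2 * (a * b * (norm (x - y))\<^sup>2) \<le> t"
    using ab by (simp flip: distrib_right)
  then show "a *\<^sub>R x + b *\<^sub>R y \<in> {z. prox_objective f v z \<le> ereal t}"
    using prox_objective_strongly_convex[OF assms, of v x t y t a b] xy ab
    by (auto elim: order_trans)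
qed

text \<open>Otherwise the sublevel sets at \<open>- real n\<close> within the ball are nested and
  nonempty, and a common point has value -\<infinity>.\<close>

lemma prox_objective_bounded_below:
  fixes f :: "'a::{real_inner, complete_space} \<Rightarrow> ereal"
  assumes f: "closed_fun f" "convex_fun f" and ninf: "\<And>x. f x \<noteq> -\<infinity>"
  obtains b where "\<And>x. x \<in> cball x0 r \<Longrightarrow> ereal b \<le> prox_objective f v x"
proof (rule ccontr)
  assume "\<not> thesis"
  then have *: "\<exists>x\<in>cball x0 r. prox_objective f v x < ereal b" for b
    using that by (meson not_le)
  define C where "C n = cball x0 r \<inter> {z. prox_objective f v z \<le> ereal (- real n)}" for n
  have "C n \<noteq> {}" for n
    using *[of "- real n"] by (auto simp: C_def intro: less_imp_le)
  moreover have "closed (C n)" "convex (C n)" for n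
    unfolding C_def
    by (intro closed_Int convex_Int closed_cball convex_cball closed_prox_objective_sublevel
        convex_prox_objective_sublevel f)+
  moreover have "C n \<subseteq> C m" if "m \<le> n" for m n
    using that by (auto simp: C_def elim: order_trans)
  moreover have "bounded (C 0)"
    unfolding C_def by (simp add: bounded_Int)
  ultimately obtain x where x: "\<And>n. x \<in> C n"
    using nested_closed_convex_nonempty[of C] by metis
  have "prox_objective f v x \<noteq> -\<infinity>"
    using ninf[of x] by (simp add: prox_objective_def)
  moreover have "prox_objective f v x \<le> ereal (- real n)" for n
    using x[of n] by (simp add: C_def)
  ultimately show False
  proof (cases "prox_objective f v x")
    case (real p)
    obtain n where "- p < real n" using reals_Archimedean2 by blast
    then show False
      using \<open>\<And>n. prox_objective f v x \<le> ereal (- real n)\<close>[of n] real by simp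
  qed auto
qed

text \<open>Strong convexity along the ray from x0 turns a lower bound on the unit ball around x0 into
  quadratic growth outside it.\<close>

lemma bounded_prox_objective_sublevel:
  fixes f :: "'a::{real_inner, complete_space} \<Rightarrow> ereal"
  assumes f: "closed_fun f" "convex_fun f" "proper_fun f"
  shows "bounded {z. prox_objective f v z \<le> ereal c}"
proof -
  have ninf: "\<And>x. f x \<noteq> -\<infinity>" using f(3) by (simp add: proper_fun_def)
  obtain x0 where "f x0 \<noteq> \<infinity>" using f(3) by (auto simp: proper_fun_def)
  then obtain p where p: "prox_objective f v x0 \<le> ereal p"
    using ninf[of x0] by (cases "f x0") (auto simp: prox_objective_def)
  obtain b where b: "\<And>x. x \<in> cball x0 1 \<Longrightarrow> ereal b \<le> prox_objective f v x"
    using prox_objective_bounded_below[OF f(1,2) ninf] by metis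
  \<comment> \<open>Strong convexity yields \<open>(r - 1) * r\<close> on the left and terms at most
    linear in \<open>r\<close> on the right; dividing by \<open>r\<close> gives the
    constant.\<close>
  have "dist x0 x \<le> 1 + 2 * (\<bar>p\<bar> + \<bar>b\<bar> + \<bar>c\<bar>)" if x: "prox_objective f v x \<le> ereal c" for x
  proof (cases "dist x0 x \<le> 1")
    case True
    then show ?thesis by simp
  next
    case False
    define r where "r = norm (x0 - x)"
    have r: "r > 1" using False by (simp add: r_def dist_norm)
    have r': "0 \<le> 1/r" "1/r \<le> 1" using r by simp_all
    \<comment> \<open>The point of the segment from \<open>x0\<close> to \<open>x\<close> at
      distance 1 from \<open>x0\<close>, where the lower bound \<open>b\<close> applies.\<close>
    define w where "w = (1 - 1/r) *\<^sub>R x0 + (1/r) *\<^sub>R x"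
    have "x0 - w = (1/r) *\<^sub>R (x0 - x)"
      by (simp add: w_def algebra_simps)
    then have "w \<in> cball x0 1"
      using r by (simp add: dist_norm r_def)
    then have "ereal b \<le> prox_objective f v w" by (rule b)
    also have "\<dots> \<le> ereal ((1 - 1/r) * p + (1/r) * c - 1/2 * ((1 - 1/r) * (1/r) * r\<^sup>2))"
      unfolding w_def r_def
      by (rule prox_objective_strongly_convex[OF f(2) p x]) (use r' in \<open>simp_all add: r_def\<close>)
    finally have "b * r \<le> ((1 - 1/r) * p + (1/r) * c - 1/2 * ((1 - 1/r) * (1/r) * r\<^sup>2)) * r"
      using r by (intro mult_right_mono) auto
    also have "\<dots> = (r - 1) * p + c - 1/2 * ((r - 1) * r)"
      using r by (simp add: field_simps power2_eq_square)
    finally have "(r - 1) * r \<le> 2 * ((r - 1) * p + c - b * r)"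
      by simp
    also have "\<dots> \<le> 2 * (r * \<bar>p\<bar> + r * \<bar>c\<bar> + r * \<bar>b\<bar>)"
    proof -
      have "(r - 1) * p \<le> (r - 1) * \<bar>p\<bar>" "(r - 1) * \<bar>p\<bar> \<le> r * \<bar>p\<bar>"
        using r by (auto intro!: mult_left_mono mult_right_mono)
      moreover have "c \<le> \<bar>c\<bar>" by simp
      moreover have "1 * \<bar>c\<bar> \<le> r * \<bar>c\<bar>"
        using r by (intro mult_right_mono) auto
      moreover have "r * - b \<le> r * \<bar>b\<bar>"
        using r by (intro mult_left_mono) auto
      ultimately have "(r - 1) * p + c + r * - b \<le> r * \<bar>p\<bar> + r * \<bar>c\<bar> + r * \<bar>b\<bar>"
        by linarith
      then show ?thesis by (simp add: mult.commute)
    qed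
    also have "\<dots> = 2 * (\<bar>p\<bar> + \<bar>b\<bar> + \<bar>c\<bar>) * r"
      by (simp add: algebra_simps)
    finally have "r - 1 \<le> 2 * (\<bar>p\<bar> + \<bar>b\<bar> + \<bar>c\<bar>)"
      using r by (intro mult_right_le_imp_le[of "r - 1" r]) auto
    then show ?thesis
      by (simp add: r_def dist_norm)
  qed
  then show ?thesis
    by (auto simp: bounded_def)
qed

section \<open>Existence and uniqueness of minimizers\<close>

text \<open>A common point of the sublevel sets just above the infimum is a minimizer; strong
  convexity at the midpoint excludes a second one.\<close>

theorem prox_objective_unique_minimizer:
  fixes f :: "'a::{real_inner, complete_space} \<Rightarrow> ereal"
  assumes f: "closed_fun f" "convex_fun f" "proper_fun f"
  shows "\<exists>!z. is_arg_min (prox_objective f v) (\<lambda>_. True) z"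
proof -
  let ?g = "prox_objective f v"
  have ninf: "\<And>x. f x \<noteq> -\<infinity>" using f(3) by (simp add: proper_fun_def)
  obtain x0 where "f x0 \<noteq> \<infinity>" using f(3) by (auto simp: proper_fun_def)
  then obtain p where p: "?g x0 \<le> ereal p"
    using ninf[of x0] by (cases "f x0") (auto simp: prox_objective_def)
  have g_ninf: "?g x \<noteq> -\<infinity>" for x
    using ninf[of x] by (simp add: prox_objective_def)
  \<comment> \<open>Real upper bounds of values instead of values, so that the infimum is taken in
    the reals.\<close>
  define X where "X = {t. \<exists>x. ?g x \<le> ereal t}"
  have "bounded {z. ?g z \<le> ereal p}"
    by (rule bounded_prox_objective_sublevel[OF f])
  then obtain r where r: "{z. ?g z \<le> ereal p} \<subseteq> cball 0 r"
    unfolding bounded_iff by (metis mem_cball_0 subsetI)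
  obtain b where b: "\<And>x. x \<in> cball 0 r \<Longrightarrow> ereal b \<le> ?g x"
    using prox_objective_bounded_below[OF f(1,2) ninf] by metis
  \<comment> \<open>A point of level at most \<open>p\<close> lies in the ball, where
    \<open>b\<close> is a lower bound; elsewhere the objective exceeds \<open>p\<close>.\<close>
  have "min b p \<le> t" if "?g x \<le> ereal t" for x t
  proof (cases "?g x \<le> ereal p")
    case True
    then have "ereal b \<le> ereal t"
      using r b that by (blast intro: order_trans)
    then show ?thesis by simp
  next
    case False
    then have "ereal p \<le> ereal t"
      using that by (meson le_cases order_trans)
    then show ?thesis by simp
  qed
  then have bdd: "bdd_below X"
    by (intro bdd_belowI[of _ "min b p"]) (auto simp: X_def)
  have ne: "X \<noteq> {}" using p by (auto simp: X_def)
  define C where "C n = {z. ?g z \<le> ereal (Inf X + inverse (real (Suc n)))}" for n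
  have "C n \<noteq> {}" for n
  proof -
    obtain t where "t \<in> X" "t < Inf X + inverse (real (Suc n))"
      using cInf_lessD[OF ne, of "Inf X + inverse (real (Suc n))"] by auto
    then obtain x where "?g x \<le> ereal t" by (auto simp: X_def)
    also have "ereal t \<le> ereal (Inf X + inverse (real (Suc n)))"
      using \<open>t < _\<close> by simp
    finally show ?thesis by (auto simp: C_def)
  qed
  moreover have "C n \<subseteq> C m" if "m \<le> n" for m n
    using that by (auto simp: C_def elim!: order_trans intro!: le_imp_inverse_le)
  moreover have "closed (C n)" "convex (C n)" "bounded (C 0)" for n
    unfolding C_def
    by (intro closed_prox_objective_sublevel convex_prox_objective_sublevel
        bounded_prox_objective_sublevel f)+
  ultimately obtain z where z: "\<And>n. z \<in> C n"
    using nested_closed_convex_nonempty[of C] by metis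
  have g_z: "?g z = ereal (real_of_ereal (?g z))"
    using z[of 0] g_ninf[of z] by (cases "?g z") (auto simp: C_def)
  have "real_of_ereal (?g z) \<le> Inf X + inverse (real (Suc n))" for n
    using z[of n] by (subst (asm) C_def) (simp, subst (asm) g_z, simp)
  then have "real_of_ereal (?g z) \<le> Inf X"
    by (intro LIMSEQ_le_const[OF LIMSEQ_inverse_real_of_nat_add]) auto
  then have z_le: "?g z \<le> ereal (Inf X)"
    by (subst g_z) simp
  have min_z: "?g z \<le> ?g y" for y
  proof (cases "?g y")
    case (real t)
    then have "Inf X \<le> t" by (intro cInf_lower bdd) (auto simp: X_def intro: exI[of _ y])
    then show ?thesis
      using z_le real by (metis ereal_less_eq(3) order_trans)
  qed (use g_ninf[of y] in auto)
  show ?thesis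
  proof (rule ex1I[of _ z])
    show "is_arg_min ?g (\<lambda>_. True) z"
      using min_z by (simp add: is_arg_min_linorder)
  next
    fix w assume "is_arg_min ?g (\<lambda>_. True) w"
    then have w: "?g w \<le> ?g z" by (simp add: is_arg_min_linorder)
    define s where "s = real_of_ereal (?g z)"
    have s: "?g z = ereal s" using g_z by (simp add: s_def)
    \<comment> \<open>Together with the next bound this reads
      \<open>s \<le> s - (norm (w - z))\<^sup>2 / 8\<close>.\<close>
    have "ereal s \<le> ?g ((1/2) *\<^sub>R w + (1/2) *\<^sub>R z)"
      using min_z s by metis
    also have "\<dots> \<le> ereal (1/2 * s + 1/2 * s - 1/2 * (1/2 * (1/2) * (norm (w - z))\<^sup>2))"
      using w s by (intro prox_objective_strongly_convex f) auto
    finally show "w = z" by simp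
  qed
qed

section \<open>Riesz representation, adjoints and the weighted norm\<close>

text \<open>The representing vector is the minimizer of the quadratic functional
  \<open>\<parallel>z\<parallel>\<^sup>2 / 2 - \<phi> z\<close>.\<close>

theorem riesz_representation:
  fixes \<phi> :: "'a::{real_inner, complete_space} \<Rightarrow> real"
  assumes "bounded_linear \<phi>"
  obtains w where "\<And>x. \<phi> x = inner x w"
proof -
  interpret \<phi>: bounded_linear \<phi> by fact
  let ?f = "\<lambda>x. ereal (- \<phi> x)"
  have epi: "ereal_epigraph ?f = {z. 0 \<le> \<phi> (fst z) + snd z}"
    by (auto simp: ereal_epigraph_def)
  have "closed_fun ?f"
    unfolding closed_fun_def epi
    by (intro closed_Collect_le continuous_intros \<phi>.continuous_on)
  moreover have "convex_fun ?f"
    unfolding convex_fun_def epi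
  proof (rule convexI)
    fix x y :: "'a \<times> real" and a b :: real
    assume "x \<in> {z. 0 \<le> \<phi> (fst z) + snd z}" "y \<in> {z. 0 \<le> \<phi> (fst z) + snd z}" "0 \<le> a" "0 \<le> b"
    then have "0 \<le> a * (\<phi> (fst x) + snd x) + b * (\<phi> (fst y) + snd y)" by simp
    then show "a *\<^sub>R x + b *\<^sub>R y \<in> {z. 0 \<le> \<phi> (fst z) + snd z}"
      by (simp add: \<phi>.add \<phi>.scaleR algebra_simps)
  qed
  moreover have "proper_fun ?f"
    by (simp add: proper_fun_def)
  ultimately obtain w where w: "is_arg_min (prox_objective ?f 0) (\<lambda>_. True) w"
    using prox_objective_unique_minimizer by blast
  have "\<phi> x = inner x w" for x
  proof (cases "x = 0")
    case True then show ?thesis by (simp add: \<phi>.zero)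
  next
    case False
    define d where "d = inner x w - \<phi> x"
    \<comment> \<open>Moving from \<open>w\<close> to \<open>w + t *\<^sub>R x\<close> changes the
      functional by \<open>t * d + t\<^sup>2 * inner x x / 2\<close>. This \<open>t\<close>
      minimizes that change, with value \<open>- d\<^sup>2 / (2 * inner x x)\<close>, so minimality
      of \<open>w\<close> forces \<open>d = 0\<close>.\<close>
    define t where "t = - d / inner x x"
    have "- \<phi> w + 1/2 * inner w w \<le> - \<phi> (w + t *\<^sub>R x) + 1/2 * inner (w + t *\<^sub>R x) (w + t *\<^sub>R x)"
      using w by (simp add: is_arg_min_linorder prox_objective_def power2_norm_eq_inner)
    then have "0 \<le> t * d + 1/2 * (t * (t * inner x x))"
      by (simp add: \<phi>.add \<phi>.scaleR inner_simps inner_commute d_def algebra_simps)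
    moreover have "t * inner x x = - d"
      using False by (simp add: t_def)
    ultimately have "0 \<le> t * d" by (simp add: mult.commute)
    then have "d\<^sup>2 / inner x x \<le> 0"
      by (simp add: t_def power2_eq_square)
    moreover have "0 < inner x x"
      using False by simp
    ultimately have "d = 0"
      by (simp add: divide_le_0_iff)
    then show ?thesis by (simp add: d_def)
  qed
  then show thesis by (rule that)
qed

text \<open>\<open>adjoint\<close> is defined by choice, so its identity holds only once some
  adjoint exists; Riesz supplies one.\<close>

lemma inner_adjoint:
  fixes T :: "'a::{real_inner, complete_space} \<Rightarrow> 'b::real_inner"
  assumes "bounded_linear T"
  shows "inner (T x) y = inner x (adjoint T y)"
proof -
  have "\<exists>w. \<forall>x. inner (T x) y = inner x w" for y
    using riesz_representation[OF bounded_linear_compose[OF bounded_linear_inner_left assms]]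
    by metis
  then obtain T' where "\<forall>x y. inner (T x) y = inner x (T' y)" by metis
  then show ?thesis
    using adjoint_unique by metis
qed

text \<open>Without surjectivity of the adjoint, which rests on the bounded inverse theorem,
  \<open>inv M\<close> would be a junk value.\<close>

lemma weighted_norm_sq_inv_comp_adjoint:
  fixes S :: "'a::{real_inner, complete_space} \<Rightarrow> 'a"
  assumes S: "bounded_linear S" and bij: "bij S"
  shows "weighted_norm_sq (inv (S \<circ> adjoint S)) u = (norm (inv S u))\<^sup>2"
proof -
  let ?B = "adjoint (inv S)"
  have R: "bounded_linear (inv S)" by (rule bounded_linear_inv[OF S bij])
  have inv: "S (inv S x) = x" "inv S (S x) = x" for x
    using bij by (simp_all add: bij_def surj_f_inv_f)
  \<comment> \<open>Transposing the identities between \<open>S\<close> and \<open>inv S\<close>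
    makes \<open>?B\<close> a two-sided inverse of \<open>adjoint S\<close>; boundedness of
    \<open>inv S\<close> gives \<open>?B\<close> the adjoint identity.\<close>
  have AB: "adjoint S (?B w) = w" for w
    by (rule vector_eq_ldot[THEN iffD1])
      (simp add: inv flip: inner_adjoint[OF S] inner_adjoint[OF R])
  have BA: "?B (adjoint S w) = w" for w
    by (rule vector_eq_ldot[THEN iffD1])
      (simp add: inv flip: inner_adjoint[OF S] inner_adjoint[OF R])
  have "inv (S \<circ> adjoint S) u = ?B (inv S u)"
  proof (rule inv_f_eq)
    show "inj (S \<circ> adjoint S)"
      by (rule inj_on_inverseI[of _ "\<lambda>y. ?B (inv S y)"]) (simp add: inv BA)
    show "(S \<circ> adjoint S) (?B (inv S u)) = u"
      by (simp add: AB inv)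
  qed
  then show ?thesis
    by (simp add: weighted_norm_sq_def power2_norm_eq_inner flip: inner_adjoint[OF R])
qed

section \<open>Transfer of the minimization problem along \<open>S\<close>\<close>

lemma closed_convex_proper_comp:
  assumes S: "bounded_linear S" and surj: "surj S"
    and f: "closed_fun f" "convex_fun f" "proper_fun f"
  shows "closed_fun (\<lambda>z. f (S z))" "convex_fun (\<lambda>z. f (S z))" "proper_fun (\<lambda>z. f (S z))"
proof -
  interpret S: bounded_linear S by fact
  have epi: "ereal_epigraph (\<lambda>z. f (S z)) = (\<lambda>p. (S (fst p), snd p)) -` ereal_epigraph f"
    by (auto simp: ereal_epigraph_def)
  show "closed_fun (\<lambda>z. f (S z))"
    using f(1) unfolding closed_fun_def epi
    by (intro closed_vimage) (auto intro!: continuous_intros S.continuous_on)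
  have "linear (\<lambda>p. (S (fst p), snd p :: real))"
    by (intro linearI) (auto simp: S.add S.scaleR)
  then show "convex_fun (\<lambda>z. f (S z))"
    using f(2) unfolding convex_fun_def epi by (intro convex_linear_vimage)
  show "proper_fun (\<lambda>z. f (S z))"
    using f(3) surj unfolding proper_fun_def by (metis surjD)
qed

text \<open>A bijective substitution maps minimizers to minimizers; uniqueness is what lets
  \<open>THE\<close> pick corresponding points.\<close>

lemma the_minimizer_comp_bij:
  assumes bij: "bij h" and ex1: "\<exists>!z. is_arg_min g (\<lambda>_. True) z"
  shows "h (the_minimizer (\<lambda>z. g (h z))) = the_minimizer g"
proof -
  have iff: "is_arg_min (\<lambda>z. g (h z)) (\<lambda>_. True) x \<longleftrightarrow> is_arg_min g (\<lambda>_. True) (h x)" for x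
    using bij by (auto simp: is_arg_min_def) (metis bij_pointE)
  obtain z where z: "is_arg_min g (\<lambda>_. True) z" "\<And>y. is_arg_min g (\<lambda>_. True) y \<Longrightarrow> y = z"
    using ex1 by metis
  have "the_minimizer g = z"
    unfolding the_minimizer_def by (rule the_equality) (fact z)+
  moreover have "the_minimizer (\<lambda>z. g (h z)) = inv h z"
    unfolding the_minimizer_def iff
  proof (rule the_equality)
    show "is_arg_min g (\<lambda>_. True) (h (inv h z))"
      using z(1) bij by (simp add: bij_def surj_f_inv_f)
    show "x = inv h z" if "is_arg_min g (\<lambda>_. True) (h x)" for x
      using z(2)[OF that] bij by (metis bij_inv_eq_iff)
  qed
  ultimately show ?thesis
    using bij by (simp add: bij_def surj_f_inv_f)
qed

theorem lemma2p2:
  fixes f :: "'a::{real_inner, complete_space} \<Rightarrow> ereal"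
    and S M :: "'a \<Rightarrow> 'a"
  assumes "closed_fun f" and "convex_fun f" and "proper_fun f"
    and "bounded_linear S" and "bij S"
    and "M = S \<circ> adjoint S"
  shows "\<forall>v. prox_new f S v = inv S (prox_classical M f (S v)) \<and>
             prox_classical M f v = S (prox_new f S (inv S v))"
proof -
  have bij: "bij S" by fact
  have inv: "S (inv S x) = x" "inv S (S x) = x" for x
    using bij by (simp_all add: bij_def surj_f_inv_f)
  have new: "prox_new f S v = the_minimizer (prox_objective (\<lambda>z. f (S z)) v)" for v
    by (simp add: prox_new_def prox_objective_def[abs_def])
  have "inv S (z - v) = inv S z - inv S v" for z v
    using bounded_linear.linear[OF bounded_linear_inv[OF assms(4) bij]] by (rule linear_diff)
  \<comment> \<open>Here \<open>f z\<close> is \<open>f (S (inv S z))\<close>, and the weighted norm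
    of \<open>z - v\<close> is the norm of \<open>inv S z - inv S v\<close>.\<close>
  then have classical: "prox_classical M f v
    = the_minimizer (\<lambda>z. prox_objective (\<lambda>z. f (S z)) (inv S v) (inv S z))" for v
    using assms(4-6)
    by (simp add: prox_classical_def prox_objective_def weighted_norm_sq_inv_comp_adjoint inv)
  note comp = closed_convex_proper_comp[OF assms(4) bij_is_surj[OF bij] assms(1-3)]
  \<comment> \<open>Applying \<open>S\<close> gives the second identity; taking \<open>S v\<close>
    for \<open>v\<close> gives the first.\<close>
  have "inv S (prox_classical M f v) = prox_new f S (inv S v)" for v
    unfolding new classical
    by (rule the_minimizer_comp_bij[OF bij_imp_bij_inv[OF bij]
          prox_objective_unique_minimizer[OF comp]])
  then show ?thesis
    using inv by metis
qed

end
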